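(* Consider the Gaussian $J$-armed bandit with horizon $N=MK$, parameter $\theta=(m_1,\dots,m_J)$, $m_\ell=m+d_\ell(D/N)^{1/2}$ with $m\in(-\infty,+\infty)$ and $|d_\ell|\le C<\infty$, controlled by the batch UCB strategy $\sigma$ with constant $a>0$ (all as defined in the context). Put $\varepsilon=K^{-1}$, $t=kK^{-1}$, $t_\ell=k_\ell K^{-1}$, and $$u_\ell(t)=\bigl(U_\ell(k)-Mm\bigr)(MD)^{-1/2}K^{1/2},\qquad Y_\ell(\varepsilon;i)=(MDK)^{-1/2}\,Y_\ell(MD;i),\qquad \zeta_\ell(t)=\zeta_\ell(k).$$ Then the following hold. (i) (Invariant description on the unit horizon.) The random variables $Y_\ell(\varepsilon;i)$ ($\ell=1,\dots,J$; $i=1,\dots,K$) are i.i.d. normal with mean $0$ and variance $\varepsilon$. For each $k$, the transformation $U_\ell(k)\mapsto u_\ell(t)$ preserves the ordering of the bounds over $\ell$, so that $\sigma$ chooses at each step after the initial ones the action with the largest $u_\ell(t)$. Moreover $$u_\ell(t)=d_\ell+\frac{\sum_{i=1}^{k} I_\ell(i)\,Y_\ell(\varepsilon;i)}{t_\ell}+\frac{a}{t_\ell^{1/2}}\bigl(2+\zeta_\ell(t)\bigr)$$ for $\ell=1,\dots,J$ and $t=k\varepsilon$, $k=J,J+1,\dots,K$. (ii) (Scaled loss.) If the actions are labelled so that $d_1=\max(d_1,\dots,d_J)$, then $$(DN)^{-1/2}L_N(\sigma,\theta)=\sum_{\ell=2}^{J}(d_1-d_\ell)\,\mathbf{E}_{\sigma,\theta}\Bigl(\sum_{k=1}^{K}\varepsilon\,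 I_\ell(k)\Bigr).$$ (iii) For given $J$, $a$ and $d_1,\dots,d_J$, the expressions in (i) and (ii) depend only on the number $K$ of processed batches: the joint distribution of the family $\{u_\ell(t)\},\{I_\ell(k)\}$ and the value of $(DN)^{-1/2}L_N(\sigma,\theta)$ are determined by $K$ and do not otherwise depend on $M$, $N$, $D$, $m$.
   Context: Gaussian multi-armed bandit: there are $J\ge 2$ actions and a controlled random process of incomes $\xi_n$, $n=1,\dots,N$. If the action chosen at time $n$ is $y_n=\ell$, then the income $\xi_n$ depends only on this action and is normally distributed with mean $m_\ell$ and known variance $D>0$. Equivalently, $\xi_n=m_{y_n}+\eta_{y_n,n}$, where $\{\eta_{\ell,n}\}$ are i.i.d. normal with mean $0$ and variance $D$, and $y_n$ depends only on past incomes and auxiliary randomization independent of $\{\eta_{\ell,n}\}$. The parameter is $\theta=(m_1,\dots,m_J)$. The set of admissible parameters is $$\Theta=\{m_\ell=m+d_\ell(D/N)^{1/2};\ m\in(-\infty,+\infty),\ |d_\ell|\le C<\infty,\ \ell=1,\dots,J\}.$$ Loss function: for a strategy $\sigma$, $$L_N(\sigma,\theta)=\mathbf{E}_{\sigma,\theta}\Bigl(\sum_{n=1}^{N}\bigl(\max(m_1,\dots,m_J)-\xi_n\bigr)\Bigr),$$ where $\mathbf{E}_{\sigma,\theta}$ is the expectation with respect to the measure generated by $\sigma$ and $\theta$. Batch processing: $N=MK$, with $K\ge J$ batches each consisting of $M$ consecutive times (batch $i$ consists of the times $(i-1)M+1,\dots,iM$). The same action is used throughout a batch. $I_\ell(i)\in\{0,1\}$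 is the indicator that action $\ell$ is used for batch $i$. $k_\ell=\sum_{i=1}^{k}I_\ell(i)$ is the number of batches among the first $k$ to which action $\ell$ was applied. $X_\ell(k)$ is the cumulative income obtained from action $\ell$ in the first $k$ batches. Put $Y_\ell(MD;i)=\sum_{n=(i-1)M+1}^{iM}\eta_{\ell,n}$; these are i.i.d. normal with mean $0$ and variance $MD$, and $$X_\ell(k)=k_\ell M\Bigl(m+d_\ell\bigl(D/N\bigr)^{1/2}\Bigr)+\sum_{i=1}^{k}I_\ell(i)\,Y_\ell(MD;i).$$ Batch UCB strategy $\sigma$ with constant $a>0$: the first $J$ batches are processed by the actions $1,\dots,J$ in turn, once each. After $k\ge J$ batches are processed, the upper bounds are $$U_\ell(k)=\frac{X_\ell(k)}{k_\ell}+\frac{a(MD)^{1/2}}{k_\ell^{1/2}}\bigl(2+\zeta_\ell(k)\bigr),\qquad \ell=1,\dots,J,$$ where $\{\zeta_\ell(k)\}$ are i.i.d. random variables with probability density $e^{-x}$ ($x>0$), independent of the $\{\eta_{\ell,n}\}$. For $k<K$, batch $k+1$ is processed by the action $\ell$ with the largest $U_\ell(k)$ (unique with probability $1$). *)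

theory Defs
  imports "HOL-Probability.Probability"
begin

text \<open>
  Conventions. Actions are \<open>1, \<dots>, J\<close>, batches \<open>1, \<dots>, K\<close>, times \<open>1, \<dots>, N\<close>. A controlled process
  lives on a probability space carrying the noise \<open>\<eta> l n\<close>, the auxiliary randomization \<open>\<zeta> l k\<close>, and the
  random choices \<open>y i\<close>, where \<open>y i \<omega>\<close> is the action used for the whole batch \<open>i\<close>.
  Quantities depending on the rescaled time \<open>t = k / K\<close> are indexed by the number \<open>k\<close> of processed batches.
\<close>

definition arm_mean :: "real \<Rightarrow> (nat \<Rightarrow> real) \<Rightarrow> real \<Rightarrow> nat \<Rightarrow> nat \<Rightarrow> real" where
  "arm_mean m d D N l = m + d l * sqrt (D / real N)"

definition batch_of :: "nat \<Rightarrow> nat \<Rightarrow> nat" where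
  "batch_of M n = (n - 1) div M + 1"

definition income ::
  "(nat \<Rightarrow> real) \<Rightarrow> nat \<Rightarrow> (nat \<Rightarrow> nat \<Rightarrow> 'w \<Rightarrow> real) \<Rightarrow> (nat \<Rightarrow> 'w \<Rightarrow> nat) \<Rightarrow> nat \<Rightarrow> 'w \<Rightarrow> real" where
  "income \<theta> M \<eta> y n \<omega> = (let l = y (batch_of M n) \<omega> in \<theta> l + \<eta> l n \<omega>)"

definition loss ::
  "'w measure \<Rightarrow> (nat \<Rightarrow> real) \<Rightarrow> nat \<Rightarrow> nat \<Rightarrow> nat \<Rightarrow> (nat \<Rightarrow> nat \<Rightarrow> 'w \<Rightarrow> real) \<Rightarrow> (nat \<Rightarrow> 'w \<Rightarrow> nat) \<Rightarrow> real" where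
  "loss P \<theta> J M N \<eta> y =
     (LINT \<omega>|P. (\<Sum>n=1..N. Max (\<theta> ` {1..J}) - income \<theta> M \<eta> y n \<omega>))"

definition used :: "(nat \<Rightarrow> 'w \<Rightarrow> nat) \<Rightarrow> nat \<Rightarrow> nat \<Rightarrow> 'w \<Rightarrow> real" where
  "used y l i \<omega> = (if y i \<omega> = l then 1 else 0)"

definition batch_count :: "(nat \<Rightarrow> 'w \<Rightarrow> nat) \<Rightarrow> nat \<Rightarrow> nat \<Rightarrow> 'w \<Rightarrow> real" where
  "batch_count y l k \<omega> = (\<Sum>i=1..k. used y l i \<omega>)"

definition cum_income ::
  "(nat \<Rightarrow> real) \<Rightarrow> nat \<Rightarrow> (nat \<Rightarrow> nat \<Rightarrow> 'w \<Rightarrow> real) \<Rightarrow> (nat \<Rightarrow> 'w \<Rightarrow> nat) \<Rightarrow> nat \<Rightarrow> nat \<Rightarrow> 'w \<Rightarrow> real" where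
  "cum_income \<theta> M \<eta> y l k \<omega> = (\<Sum>n=1..k * M. used y l (batch_of M n) \<omega> * income \<theta> M \<eta> y n \<omega>)"

definition batch_noise :: "nat \<Rightarrow> (nat \<Rightarrow> nat \<Rightarrow> 'w \<Rightarrow> real) \<Rightarrow> nat \<Rightarrow> nat \<Rightarrow> 'w \<Rightarrow> real" where
  "batch_noise M \<eta> l i \<omega> = (\<Sum>n=(i - 1) * M + 1..i * M. \<eta> l n \<omega>)"

definition scaled_noise ::
  "nat \<Rightarrow> real \<Rightarrow> nat \<Rightarrow> (nat \<Rightarrow> nat \<Rightarrow> 'w \<Rightarrow> real) \<Rightarrow> nat \<Rightarrow> nat \<Rightarrow> 'w \<Rightarrow> real" where
  "scaled_noise M D K \<eta> l i \<omega> = batch_noise M \<eta> l i \<omega> / sqrt (real M * D * real K)"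

definition upper_bound ::
  "(nat \<Rightarrow> real) \<Rightarrow> nat \<Rightarrow> real \<Rightarrow> real \<Rightarrow> (nat \<Rightarrow> nat \<Rightarrow> 'w \<Rightarrow> real) \<Rightarrow> (nat \<Rightarrow> nat \<Rightarrow> 'w \<Rightarrow> real)
     \<Rightarrow> (nat \<Rightarrow> 'w \<Rightarrow> nat) \<Rightarrow> nat \<Rightarrow> nat \<Rightarrow> 'w \<Rightarrow> real" where
  "upper_bound \<theta> M D a \<eta> \<zeta> y l k \<omega> =
     cum_income \<theta> M \<eta> y l k \<omega> / batch_count y l k \<omega>
     + a * sqrt (real M * D) / sqrt (batch_count y l k \<omega>) * (2 + \<zeta> l k \<omega>)"

text \<open>
  The greedy rule is only required almost surely and leaves the resolution of ties open; that the
  maximizer is almost surely unique is not assumed. Independence is joint over all the noise variables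
  \<open>\<eta> l n\<close> and randomization variables \<open>\<zeta> l k\<close>. The latter are needed up to \<open>k = K\<close>, where upper bounds
  are still defined although no further batch is processed.
\<close>

locale batch_ucb_bandit = prob_space P
  for P :: "'w measure" +
  fixes J K M N :: nat and C D a m :: real and d :: "nat \<Rightarrow> real"
    and \<eta> \<zeta> :: "nat \<Rightarrow> nat \<Rightarrow> 'w \<Rightarrow> real" and y :: "nat \<Rightarrow> 'w \<Rightarrow> nat"
  assumes J_ge_2: "2 \<le> J" and J_le_K: "J \<le> K" and M_pos: "0 < M" and N_eq: "N = M * K"
    and D_pos: "0 < D" and a_pos: "0 < a"
    and d_bounded: "\<And>l. l \<in> {1..J} \<Longrightarrow> \<bar>d l\<bar> \<le> C"
    and noise_normal: "\<And>l n. l \<in> {1..J} \<Longrightarrow> n \<in> {1..N} \<Longrightarrow>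
          distributed P lborel (\<eta> l n) (normal_density 0 (sqrt D))"
    and zeta_exponential: "\<And>l k. l \<in> {1..J} \<Longrightarrow> k \<in> {J..K} \<Longrightarrow>
          distributed P lborel (\<zeta> l k) (exponential_density 1)"
    and independent: "indep_vars (\<lambda>_. borel) (case_sum (\<lambda>(l, n). \<eta> l n) (\<lambda>(l, k). \<zeta> l k))
          (({1..J} \<times> {1..N}) <+> ({1..J} \<times> {J..K}))"
    and choice_measurable: "\<And>i. i \<in> {1..K} \<Longrightarrow> y i \<in> P \<rightarrow>\<^sub>M count_space {1..J}"
    and initial_choices: "\<And>i \<omega>. i \<in> {1..J} \<Longrightarrow> \<omega> \<in> space P \<Longrightarrow> y i \<omega> = i"
    and greedy_choices: "AE \<omega> in P. \<forall>k\<in>{J..<K}. \<forall>l\<in>{1..J}.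
          upper_bound (arm_mean m d D N) M D a \<eta> \<zeta> y l k \<omega>
          \<le> upper_bound (arm_mean m d D N) M D a \<eta> \<zeta> y (y (k + 1) \<omega>) k \<omega>"

definition scaled_bound ::
  "nat \<Rightarrow> nat \<Rightarrow> nat \<Rightarrow> real \<Rightarrow> real \<Rightarrow> real \<Rightarrow> (nat \<Rightarrow> real) \<Rightarrow> (nat \<Rightarrow> nat \<Rightarrow> 'w \<Rightarrow> real)
     \<Rightarrow> (nat \<Rightarrow> nat \<Rightarrow> 'w \<Rightarrow> real) \<Rightarrow> (nat \<Rightarrow> 'w \<Rightarrow> nat) \<Rightarrow> nat \<Rightarrow> nat \<Rightarrow> 'w \<Rightarrow> real" where
  "scaled_bound K M N D a m d \<eta> \<zeta> y l k \<omega> =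
     (upper_bound (arm_mean m d D N) M D a \<eta> \<zeta> y l k \<omega> - real M * m) / sqrt (real M * D) * sqrt (real K)"

definition scaled_loss ::
  "'w measure \<Rightarrow> nat \<Rightarrow> nat \<Rightarrow> nat \<Rightarrow> real \<Rightarrow> real \<Rightarrow> (nat \<Rightarrow> real) \<Rightarrow> (nat \<Rightarrow> nat \<Rightarrow> 'w \<Rightarrow> real)
     \<Rightarrow> (nat \<Rightarrow> 'w \<Rightarrow> nat) \<Rightarrow> real" where
  "scaled_loss P J M N D m d \<eta> y = loss P (arm_mean m d D N) J M N \<eta> y / sqrt (D * real N)"

text \<open>The joint law of \<open>(u l (k / K))\<close> for \<open>k = J, \<dots>, K\<close> and of the indicators for \<open>k = 1, \<dots>, K\<close>.\<close>

definition joint_law ::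
  "'w measure \<Rightarrow> nat \<Rightarrow> nat \<Rightarrow> (nat \<Rightarrow> nat \<Rightarrow> 'w \<Rightarrow> real) \<Rightarrow> (nat \<Rightarrow> 'w \<Rightarrow> nat)
     \<Rightarrow> ((nat \<times> nat \<Rightarrow> real) \<times> (nat \<times> nat \<Rightarrow> real)) measure" where
  "joint_law P J K u y =
     distr P ((\<Pi>\<^sub>M p\<in>{1..J} \<times> {J..K}. borel) \<Otimes>\<^sub>M (\<Pi>\<^sub>M p\<in>{1..J} \<times> {1..K}. borel))
       (\<lambda>\<omega>. (\<lambda>(l, k)\<in>{1..J} \<times> {J..K}. u l k \<omega>, \<lambda>(l, k)\<in>{1..J} \<times> {1..K}. used y l k \<omega>))"

end

theory Submission
  imports Defs
begin

text \<open>
  The whole theorem rests on one reduction: after the change of variables, the bandit is driven only by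
  the scaled batch noise \<open>Y l i\<close> and the randomization \<open>\<zeta> l k\<close>, and the scaled
  bounds and the choices are almost surely functions of these alone. Summing the incomes batch by batch shows that the scaled bound is a fixed expression
  in the choices made so far, the \<open>Y l i\<close> and \<open>\<zeta> l k\<close>, in which \<open>M\<close>, \<open>N\<close>, \<open>D\<close> and \<open>m\<close> have
  cancelled (\<open>scaled_bound_formula\<close>). Since the change of variables is increasing and affine, the greedy
  rule is the greedy rule for the scaled bounds.

  The greedy rule determines the choices only where the maximizer is unique. It almost surely is: if two
  bounds agree, then \<open>\<zeta> l k\<close> equals a function of the other data, of which it is independent, and a
  variable with a density avoids such a value almost surely (\<open>no_ties\<close>). By induction on the batches, the
  choices therefore agree almost surely with those of a deterministic recursion \<open>ucb_choice\<close> applied to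
  the data (\<open>choices_strict_and_eq\<close>).

  The data form an independent family of \<open>N(0, 1/K)\<close> and standard exponential variables, so their joint
  law \<open>unit_law J K\<close> depends on \<open>J\<close> and \<open>K\<close> only. The joint law of bounds and indicators is the image of
  \<open>unit_law J K\<close> under a map that involves only \<open>J\<close>, \<open>K\<close>, \<open>a\<close> and \<open>d\<close> (\<open>joint_law_eq\<close>), which is the
  invariance claim.

  For the loss, pathwise regret is a weighted sum of the indicators minus the noise collected from the arms
  used. That noise has mean zero, because the choice for batch \<open>i\<close> is a function of the data of earlier
  batches and so is independent of \<open>Y l i\<close> (\<open>used_noise_mean_zero\<close>). What remains is the
  expected number of uses of each arm weighted by its gap (\<open>scaled_loss_eq\<close>), again a functional of \<open>unit_law J K\<close>.
\<close>

section \<open>The strategy as a function of the data on the unit horizon\<close>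

text \<open>
  Coordinates \<open>Inl (l, i)\<close> carry the scaled noise of arm \<open>l\<close> in batch \<open>i\<close>, coordinates \<open>Inr (l, k)\<close> the
  randomization of its bound after \<open>k\<close> batches. A single index type lets independence
  be stated once, for the whole family.
\<close>

type_synonym unit_data = "(nat \<times> nat) + (nat \<times> nat) \<Rightarrow> real"

text \<open>
  The rescaled count \<open>t_l = k_l / K\<close>, for a deterministic sequence of choices \<open>h\<close>.
\<close>

definition share :: "nat \<Rightarrow> (nat \<Rightarrow> nat) \<Rightarrow> nat \<Rightarrow> nat \<Rightarrow> real" where
  "share K h l k = (\<Sum>i=1..k. if h i = l then 1 else 0) / real K"

definition unit_index ::
  "nat \<Rightarrow> real \<Rightarrow> (nat \<Rightarrow> real) \<Rightarrow> (nat \<Rightarrow> nat) \<Rightarrow> unit_data \<Rightarrow> nat \<Rightarrow> nat \<Rightarrow> real" where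
  "unit_index K a d h z l k =
     d l + (\<Sum>i=1..k. (if h i = l then 1 else 0) * z (Inl (l, i))) / share K h l k
     + a / sqrt (share K h l k) * (2 + z (Inr (l, k)))"

text \<open>
  Breaking ties towards the smallest label makes the choice a total, measurable function of the data.
  Ties turn out to be null events, so any other convention would give the same law.
\<close>

definition first_maximizer :: "nat \<Rightarrow> (nat \<Rightarrow> real) \<Rightarrow> nat" where
  "first_maximizer J f = (LEAST l. l \<in> {1..J} \<and> (\<forall>j\<in>{1..J}. f j \<le> f l))"

text \<open>
  The inner conditional exposes the bound \<open>j < i\<close> to the termination proof. Its default value \<open>0\<close> is never
  read, since the index after \<open>i - 1\<close> batches involves only the choices \<open>1, \<dots>, i - 1\<close>; see \<open>ucb_choice_greedy\<close>.
\<close>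

fun ucb_choice :: "nat \<Rightarrow> nat \<Rightarrow> real \<Rightarrow> (nat \<Rightarrow> real) \<Rightarrow> unit_data \<Rightarrow> nat \<Rightarrow> nat" where
  "ucb_choice J K a d z i =
     (if i \<le> J then i
      else first_maximizer J
        (\<lambda>l. unit_index K a d (\<lambda>j. if j < i then ucb_choice J K a d z j else 0) z l (i - 1)))"

declare ucb_choice.simps [simp del]

lemma share_cong: "(\<And>i. i \<in> {1..k} \<Longrightarrow> h i = h' i) \<Longrightarrow> share K h l k = share K h' l k"
  by (simp add: share_def)

lemma unit_index_cong:
  assumes "\<And>i. i \<in> {1..k} \<Longrightarrow> h i = h' i" "\<And>i. i \<in> {1..k} \<Longrightarrow> z (Inl (l, i)) = z' (Inl (l, i))"
    "z (Inr (l, k)) = z' (Inr (l, k))"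
  shows "unit_index K a d h z l k = unit_index K a d h' z' l k"
proof -
  have "share K h l k = share K h' l k" by (rule share_cong) (rule assms)
  then show ?thesis using assms by (simp add: unit_index_def)
qed

lemma share_pos:
  assumes "\<And>i. i \<in> {1..J} \<Longrightarrow> h i = i" "l \<in> {1..J}" "J \<le> k" "0 < K"
  shows "0 < share K h l k"
proof -
  have "(1::real) = (if h l = l then 1 else 0)" using assms by simp
  also have "\<dots> \<le> (\<Sum>i=1..k. if h i = l then 1 else 0)"
    by (rule member_le_sum) (use assms in auto)
  finally show ?thesis using assms by (simp add: share_def)
qed

lemma ucb_choice_initial: "i \<le> J \<Longrightarrow> ucb_choice J K a d z i = i"
  by (simp add: ucb_choice.simps)

lemma ucb_choice_greedy:
  assumes "J \<le> k"
  shows "ucb_choice J K a d z (Suc k) =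
    first_maximizer J (\<lambda>l. unit_index K a d (ucb_choice J K a d z) z l k)"
proof -
  have "unit_index K a d (\<lambda>j. if j < Suc k then ucb_choice J K a d z j else 0) z l k
      = unit_index K a d (ucb_choice J K a d z) z l k" for l
    by (rule unit_index_cong) auto
  then show ?thesis using assms by (simp add: ucb_choice.simps[of _ _ _ _ _ "Suc k"])
qed

lemma first_maximizer_cong:
  "(\<And>l. l \<in> {1..J} \<Longrightarrow> f l = g l) \<Longrightarrow> first_maximizer J f = first_maximizer J g"
  unfolding first_maximizer_def by (rule arg_cong[where f = Least]) (auto simp: fun_eq_iff)

lemma first_maximizer_strict:
  assumes "l \<in> {1..J}" "\<And>j. j \<in> {1..J} \<Longrightarrow> j \<noteq> l \<Longrightarrow> f j < f l"
  shows "first_maximizer J f = l"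
  unfolding first_maximizer_def
proof (rule Least_equality)
  show "l \<in> {1..J} \<and> (\<forall>j\<in>{1..J}. f j \<le> f l)" using assms by force
next
  fix j assume "j \<in> {1..J} \<and> (\<forall>i\<in>{1..J}. f i \<le> f j)"
  then show "l \<le> j" using assms by (cases "j = l") force+
qed

text \<open>
  The coordinates known before batch \<open>i\<close> is processed: noise of the batches before \<open>i\<close> and the
  randomization of the bounds computed after \<open>k = J, \<dots>, i - 1\<close> batches.
\<close>

definition past :: "nat \<Rightarrow> nat \<Rightarrow> ((nat \<times> nat) + (nat \<times> nat)) set" where
  "past J i = ({1..J} \<times> {1..<i}) <+> ({1..J} \<times> {J..<i})"

text \<open>
  The strategy does not look ahead. Both independence arguments below, absence of ties and zero mean of the
  collected noise, use it to drop one coordinate of the data.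
\<close>

lemma ucb_choice_past:
  assumes "\<And>p. p \<in> past J i \<Longrightarrow> z p = z' p"
  shows "ucb_choice J K a d z i = ucb_choice J K a d z' i"
  using assms
proof (induction i rule: less_induct)
  case (less i)
  show ?case
  proof (cases "i \<le> J")
    case True
    then show ?thesis by (simp add: ucb_choice_initial)
  next
    case False
    then obtain k where k: "i = Suc k" "J \<le> k" by (cases i) auto
    have "unit_index K a d (ucb_choice J K a d z) z l k
        = unit_index K a d (ucb_choice J K a d z') z' l k" if "l \<in> {1..J}" for l
    proof (rule unit_index_cong)
      fix j assume j: "j \<in> {1..k}"
      show "ucb_choice J K a d z j = ucb_choice J K a d z' j"
        by (rule less.IH) (use j k in \<open>auto intro!: less.prems simp: past_def\<close>)
      show "z (Inl (l, j)) = z' (Inl (l, j))"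
        using that j k by (auto intro!: less.prems simp: past_def)
    next
      show "z (Inr (l, k)) = z' (Inr (l, k))"
        using that k by (auto intro!: less.prems simp: past_def)
    qed
    then show ?thesis unfolding k ucb_choice_greedy[OF k(2)] by (rule first_maximizer_cong)
  qed
qed

section \<open>Measurability\<close>

lemma measurable_share:
  assumes "\<And>i. i \<in> {1..k} \<Longrightarrow> (\<lambda>\<omega>. h \<omega> i) \<in> Q \<rightarrow>\<^sub>M count_space UNIV"
  shows "(\<lambda>\<omega>. share K (h \<omega>) l k) \<in> borel_measurable Q"
  unfolding share_def
proof (intro borel_measurable_divide borel_measurable_sum borel_measurable_const)
  fix i assume "i \<in> {1..k}"
  note assms[OF this, measurable]
  show "(\<lambda>\<omega>. if h \<omega> i = l then 1 else 0 :: real) \<in> borel_measurable Q" by measurable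
qed

lemma measurable_unit_index:
  assumes h: "\<And>i. i \<in> {1..k} \<Longrightarrow> (\<lambda>\<omega>. h \<omega> i) \<in> Q \<rightarrow>\<^sub>M count_space UNIV"
    and noise: "\<And>i. i \<in> {1..k} \<Longrightarrow> (\<lambda>\<omega>. z \<omega> (Inl (l, i))) \<in> borel_measurable Q"
    and [measurable]: "(\<lambda>\<omega>. z \<omega> (Inr (l, k))) \<in> borel_measurable Q"
  shows "(\<lambda>\<omega>. unit_index K a d (h \<omega>) (z \<omega>) l k) \<in> borel_measurable Q"
proof -
  note measurable_share[OF h, measurable]
  have [measurable]: "(\<lambda>\<omega>. \<Sum>i=1..k. (if h \<omega> i = l then 1 else 0) * z \<omega> (Inl (l, i)))
      \<in> borel_measurable Q"
  proof (rule borel_measurable_sum)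
    fix i assume i: "i \<in> {1..k}"
    note h[OF i, measurable] noise[OF i, measurable]
    show "(\<lambda>\<omega>. (if h \<omega> i = l then 1 else 0) * z \<omega> (Inl (l, i))) \<in> borel_measurable Q"
      by measurable
  qed
  show ?thesis unfolding unit_index_def by measurable
qed

text \<open>
  A coordinate outside the index set is constantly \<open>undefined\<close> on the product space. Thus functions of
  the full data are measurable on every product of coordinates, including the ones with a coordinate removed.
\<close>

lemma measurable_PiM_any_component [measurable]:
  "(\<lambda>z. z p) \<in> borel_measurable (PiM I (\<lambda>_. borel :: real measure))"
proof (cases "p \<in> I")
  case False
  then have "(\<lambda>z. z p) \<in> borel_measurable (PiM I (\<lambda>_. borel :: real measure))
      \<longleftrightarrow> (\<lambda>_. undefined :: real) \<in> borel_measurable (PiM I (\<lambda>_. borel :: real measure))"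
    by (intro measurable_cong) (auto simp: space_PiM PiE_def extensional_def)
  then show ?thesis by simp
qed measurable

lemma measurable_ucb_choice [measurable]:
  "(\<lambda>z. ucb_choice J K a d z i) \<in> PiM I (\<lambda>_. borel) \<rightarrow>\<^sub>M count_space UNIV"
proof (induction i rule: less_induct)
  case (less i)
  show ?case
  proof (cases "i \<le> J")
    case True
    then show ?thesis by (simp add: ucb_choice_initial)
  next
    case False
    then obtain k where k: "i = Suc k" "J \<le> k" by (cases i) auto
    have [measurable]: "(\<lambda>z. unit_index K a d (ucb_choice J K a d z) z l k)
        \<in> borel_measurable (PiM I (\<lambda>_. borel))" for l
      by (rule measurable_unit_index) (use k in \<open>auto intro!: less.IH\<close>)
    have [measurable]: "Measurable.pred (PiM I (\<lambda>_. borel))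
        (\<lambda>z. unit_index K a d (ucb_choice J K a d z) z j k
          \<le> unit_index K a d (ucb_choice J K a d z) z l k)" for j l
      unfolding Measurable.pred_def by (rule borel_measurable_le) measurable
    show ?thesis unfolding k ucb_choice_greedy[OF k(2)] first_maximizer_def by measurable
  qed
qed

lemma measurable_unit_index_ucb_choice [measurable]:
  "(\<lambda>z. unit_index K a d (ucb_choice J K a d z) z l k) \<in> borel_measurable (PiM I (\<lambda>_. borel))"
  by (rule measurable_unit_index) auto

section \<open>Independence\<close>

text \<open>
  By independence and Fubini it suffices to fix the value \<open>w\<close> of \<open>W\<close>; then \<open>{w}\<close> is a Lebesgue null set,
  hence null for the law of \<open>X\<close>.
\<close>

lemma (in prob_space) AE_indep_absolutely_continuous_neq:
  fixes X W :: "'a \<Rightarrow> real"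
  assumes indep: "indep_var borel W borel X" and dens: "distributed M lborel X f"
  shows "AE \<omega> in M. W \<omega> \<noteq> X \<omega>"
proof -
  have rv [measurable]: "random_variable borel W" "random_variable borel X"
    and joint: "distr M borel W \<Otimes>\<^sub>M distr M borel X
      = distr M (borel \<Otimes>\<^sub>M borel) (\<lambda>\<omega>. (W \<omega>, X \<omega>))"
    using indep unfolding indep_var_distribution_eq by auto
  interpret W: prob_space "distr M borel W" by (rule prob_space_distr) simp
  interpret X: prob_space "distr M borel X" by (rule prob_space_distr) simp
  interpret WX: pair_sigma_finite "distr M borel W" "distr M borel X" ..
  have law: "distr M borel X = density lborel f"
    using distributed_distr_eq_density[OF dens] by (simp cong: distr_cong)
  have [measurable]: "f \<in> borel_measurable lborel"
    using dens by (rule distributed_borel_measurable)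
  have "AE x in distr M borel X. w \<noteq> x" for w
    unfolding law by (subst AE_density) (use AE_lborel_singleton[of w] in auto)
  moreover have "{p \<in> space (distr M borel W \<Otimes>\<^sub>M distr M borel X). fst p \<noteq> snd p}
      \<in> sets (distr M borel W \<Otimes>\<^sub>M distr M borel X)"
    by measurable
  ultimately have "AE p in distr M borel W \<Otimes>\<^sub>M distr M borel X. fst p \<noteq> snd p"
    by (intro WX.AE_pair_measure) simp_all
  then show ?thesis unfolding joint by (subst (asm) AE_distr_iff) auto
qed

lemma (in prob_space) indep_var_function_of_other_coordinates:
  assumes indep: "indep_vars (\<lambda>_. borel) (\<lambda>p \<omega>. X \<omega> p :: real) I" and "p \<in> I"
    and f: "f \<in> PiM (I - {p}) (\<lambda>_. borel) \<rightarrow>\<^sub>M borel"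
    and other: "\<And>z. f (restrict z (I - {p})) = f z"
  shows "indep_var borel (\<lambda>\<omega>. f (X \<omega>)) borel (\<lambda>\<omega>. X \<omega> p)"
proof -
  have "indep_var (PiM (I - {p}) (\<lambda>_. borel)) (\<lambda>\<omega>. restrict (X \<omega>) (I - {p}))
      (PiM {p} (\<lambda>_. borel)) (\<lambda>\<omega>. restrict (X \<omega>) {p})"
    using indep_var_restrict[OF indep, of "I - {p}" "{p}"] \<open>p \<in> I\<close> by simp
  from indep_var_compose[OF this f, of "\<lambda>z. z p" borel] show ?thesis
    by (simp add: other comp_def)
qed


lemma (in prob_space) indep_vars_reindex_inj:
  assumes indep: "indep_vars (\<lambda>_. borel) (X :: 'i \<Rightarrow> 'a \<Rightarrow> real) I"
    and inj: "inj_on g L" and sub: "g ` L \<subseteq> I"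
  shows "indep_vars (\<lambda>_. borel) (\<lambda>j. X (g j)) L"
proof -
  have "indep_vars (\<lambda>j. PiM {g j} (\<lambda>_. borel)) (\<lambda>j \<omega>. restrict (\<lambda>i. X i \<omega>) {g j}) L"
    by (rule indep_vars_restrict[OF indep])
       (use sub inj in \<open>auto simp: disjoint_family_on_def inj_on_def\<close>)
  then have "indep_vars (\<lambda>_. borel) (\<lambda>j \<omega>. restrict (\<lambda>i. X i \<omega>) {g j} (g j)) L"
    by (rule indep_vars_compose2) simp
  then show ?thesis by simp
qed

section \<open>Batches\<close>

lemma batch_of_eq:
  assumes "0 < M" "1 \<le> i" "n \<in> {(i - 1) * M + 1..i * M}"
  shows "batch_of M n = i"
proof -
  obtain j where j: "i = Suc j" using assms by (cases i) auto
  have "(n - 1) div M = j"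
    by (rule div_nat_eqI) (use assms j in \<open>auto simp: algebra_simps\<close>)
  then show ?thesis by (simp add: batch_of_def j)
qed

lemma sum_over_batches:
  fixes f :: "nat \<Rightarrow> 'b::comm_monoid_add"
  shows "(\<Sum>n=1..k * M. f n) = (\<Sum>i=1..k. \<Sum>n=(i - 1) * M + 1..i * M. f n)"
proof (induction k)
  case (Suc k)
  have "(\<Sum>n=1..Suc k * M. f n) = (\<Sum>n=1..k * M. f n) + (\<Sum>n=k * M + 1..k * M + M. f n)"
    using sum.ub_add_nat[of 1 "k * M" f M] by (simp add: add.commute)
  then show ?case using Suc by (simp add: add.commute)
qed simp

lemma sum_batch_of:
  fixes f :: "nat \<Rightarrow> nat \<Rightarrow> 'b::comm_monoid_add"
  assumes "0 < M"
  shows "(\<Sum>n=1..k * M. f (batch_of M n) n) = (\<Sum>i=1..k. \<Sum>n=(i - 1) * M + 1..i * M. f i n)"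
  unfolding sum_over_batches using batch_of_eq[OF assms]
  by (intro sum.cong refl) (metis atLeastAtMost_iff)

lemma sum_income_over_batch:
  assumes "1 \<le> i"
  shows "(\<Sum>n=(i - 1) * M + 1..i * M. \<theta> l + \<eta> l n \<omega>) = real M * \<theta> l + batch_noise M \<eta> l i \<omega>"
proof -
  obtain j where "i = Suc j" using assms by (cases i) auto
  then show ?thesis by (simp add: sum.distrib batch_noise_def)
qed

text \<open>
  The income of an arm is collected only in batches in which that arm is used, so its mean may be taken to be \<open>\<theta> l\<close> in
  every term.
\<close>

lemma cum_income_eq:
  assumes "0 < M"
  shows "cum_income \<theta> M \<eta> y l k \<omega> = real M * \<theta> l * batch_count y l k \<omega>
    + (\<Sum>i=1..k. used y l i \<omega> * batch_noise M \<eta> l i \<omega>)"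
proof -
  have "cum_income \<theta> M \<eta> y l k \<omega>
      = (\<Sum>i=1..k. \<Sum>n=(i - 1) * M + 1..i * M. used y l i \<omega> * (\<theta> (y i \<omega>) + \<eta> (y i \<omega>) n \<omega>))"
    unfolding cum_income_def income_def Let_def by (rule sum_batch_of[OF assms])
  also have "\<dots> = (\<Sum>i=1..k. used y l i \<omega> * (real M * \<theta> l + batch_noise M \<eta> l i \<omega>))"
  proof (rule sum.cong[OF refl])
    fix i assume "i \<in> {1..k}"
    then show "(\<Sum>n=(i - 1) * M + 1..i * M. used y l i \<omega> * (\<theta> (y i \<omega>) + \<eta> (y i \<omega>) n \<omega>))
        = used y l i \<omega> * (real M * \<theta> l + batch_noise M \<eta> l i \<omega>)"
      using sum_income_over_batch[of i \<theta> l \<eta> \<omega> M]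
      by (simp add: used_def flip: sum_distrib_left)
  qed
  also have "\<dots> = real M * \<theta> l * batch_count y l k \<omega>
    + (\<Sum>i=1..k. used y l i \<omega> * batch_noise M \<eta> l i \<omega>)"
    by (simp add: batch_count_def sum_distrib_left sum.distrib algebra_simps)
  finally show ?thesis .
qed

section \<open>The law of the data on the unit horizon\<close>

definition unit_data_of ::
  "nat \<Rightarrow> real \<Rightarrow> nat \<Rightarrow> (nat \<Rightarrow> nat \<Rightarrow> 'w \<Rightarrow> real) \<Rightarrow> (nat \<Rightarrow> nat \<Rightarrow> 'w \<Rightarrow> real) \<Rightarrow> 'w \<Rightarrow> unit_data"
  where
  "unit_data_of M D K \<eta> \<zeta> \<omega> =
     case_sum (\<lambda>(l, i). scaled_noise M D K \<eta> l i \<omega>) (\<lambda>(l, k). \<zeta> l k \<omega>)"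

definition unit_coordinates :: "nat \<Rightarrow> nat \<Rightarrow> ((nat \<times> nat) + (nat \<times> nat)) set" where
  "unit_coordinates J K = ({1..J} \<times> {1..K}) <+> ({1..J} \<times> {J..K})"

text \<open>
  The law of the data for every bandit with \<open>J\<close> arms and \<open>K\<close> batches; see \<open>distr_unit_data\<close>.
\<close>

definition unit_law :: "nat \<Rightarrow> nat \<Rightarrow> unit_data measure" where
  "unit_law J K = (\<Pi>\<^sub>M p\<in>unit_coordinates J K.
     case p of Inl _ \<Rightarrow> density lborel (normal_density 0 (sqrt (1 / real K)))
     | Inr _ \<Rightarrow> density lborel (exponential_density 1))"

lemma unit_data_of_simps [simp]:
  "unit_data_of M D K \<eta> \<zeta> \<omega> (Inl (l, i)) = scaled_noise M D K \<eta> l i \<omega>"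
  "unit_data_of M D K \<eta> \<zeta> \<omega> (Inr (l, k)) = \<zeta> l k \<omega>"
  by (simp_all add: unit_data_of_def)

context batch_ucb_bandit
begin

abbreviation unit_data where "unit_data \<equiv> unit_data_of M D K \<eta> \<zeta>"

abbreviation u where "u \<equiv> scaled_bound K M N D a m d \<eta> \<zeta> y"

abbreviation choice where "choice \<omega> \<equiv> ucb_choice J K a d (unit_data \<omega>)"

lemma K_pos: "0 < K" using J_ge_2 J_le_K by simp

text \<open>
  Each scaled batch noise is a function of its own block of the noise variables, and these blocks
  are disjoint, as a time lies in one batch only.
\<close>

lemma indep_unit_data: "indep_vars (\<lambda>_. borel) (\<lambda>p \<omega>. unit_data \<omega> p) (unit_coordinates J K)"
proof -
  define block :: "nat \<times> nat + nat \<times> nat \<Rightarrow> (nat \<times> nat + nat \<times> nat) set" where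
    "block = case_sum (\<lambda>(l, i). Inl ` ({l} \<times> {(i - 1) * M + 1..i * M})) (\<lambda>q. {Inr q})"
  define f :: "nat \<times> nat + nat \<times> nat \<Rightarrow> (nat \<times> nat + nat \<times> nat \<Rightarrow> real) \<Rightarrow> real" where
    "f = case_sum (\<lambda>(l, i) v. (\<Sum>n=(i - 1) * M + 1..i * M. v (Inl (l, n))) / sqrt (real M * D * real K))
       (\<lambda>q v. v (Inr q))"
  define X where "X = case_sum (\<lambda>(l, n). \<eta> l n) (\<lambda>(l, k). \<zeta> l k)"
  have "indep_vars (\<lambda>p. PiM (block p) (\<lambda>_. borel)) (\<lambda>p \<omega>. restrict (\<lambda>q. X q \<omega>) (block p))
      (unit_coordinates J K)"
  proof (rule indep_vars_restrict[OF independent[folded X_def]])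
    show "block p \<subseteq> ({1..J} \<times> {1..N}) <+> ({1..J} \<times> {J..K})" if "p \<in> unit_coordinates J K" for p
    proof -
      have "n \<le> N" if "n \<le> i * M" "i \<le> K" for n i
        using that N_eq by (metis le_trans mult.commute mult_le_mono1)
      then show ?thesis using that by (auto simp: unit_coordinates_def block_def)
    qed
    show "disjoint_family_on block (unit_coordinates J K)"
      unfolding disjoint_family_on_def
    proof (intro ballI impI)
      fix p q assume pq: "p \<in> unit_coordinates J K" "q \<in> unit_coordinates J K" "p \<noteq> q"
      have batch: "i = j" if "n \<in> {(i - 1) * M + 1..i * M}" "n \<in> {(j - 1) * M + 1..j * M}" "1 \<le> i" "1 \<le> j"
        for n i j using batch_of_eq[OF M_pos] that by metis
      show "block p \<inter> block q = {}"
        using pq batch by (fastforce simp: unit_coordinates_def block_def)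
    qed
  qed
  then have "indep_vars (\<lambda>_. borel) (\<lambda>p \<omega>. f p (restrict (\<lambda>q. X q \<omega>) (block p))) (unit_coordinates J K)"
    by (rule indep_vars_compose2) (auto simp: f_def split: sum.split)
  moreover have "f p (restrict (\<lambda>q. X q \<omega>) (block p)) = unit_data \<omega> p" for p \<omega>
    by (cases p) (auto simp: f_def block_def X_def unit_data_of_def scaled_noise_def batch_noise_def
        intro!: sum.cong arg_cong2[where f = "(/)"])
  ultimately show ?thesis by simp
qed

text \<open>
  Variances of independent normal variables add: \<open>M D / (M D K) = 1 / K\<close>.
\<close>

lemma scaled_noise_normal:
  assumes l: "l \<in> {1..J}" and i: "i \<in> {1..K}"
  shows "distributed P lborel (scaled_noise M D K \<eta> l i) (normal_density 0 (sqrt (1 / real K)))"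
proof -
  let ?B = "{(i - 1) * M + 1..i * M}"
  obtain j where j: "i = Suc j" using i by (cases i) auto
  have card: "card ?B = M" "?B \<noteq> {}" using M_pos by (simp_all add: j)
  have variance: "(\<Sum>n\<in>?B. (sqrt D)\<^sup>2) = real M * D"
    unfolding sum_constant card using D_pos by simp
  have B: "?B \<subseteq> {1..N}" using i N_eq by (auto intro: order_trans[OF _ mult_le_mono1])
  have "indep_vars (\<lambda>_. borel) (\<lambda>n. case_sum (\<lambda>(l, n). \<eta> l n) (\<lambda>(l, k). \<zeta> l k) (Inl (l, n))) ?B"
    by (rule indep_vars_reindex_inj[OF independent]) (use l B in \<open>auto simp: inj_on_def\<close>)
  then have "distributed P lborel (\<lambda>\<omega>. \<Sum>n\<in>?B. \<eta> l n \<omega>)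
      (normal_density (\<Sum>n\<in>?B. 0) (sqrt (\<Sum>n\<in>?B. (sqrt D)\<^sup>2)))"
    by (intro sum_indep_normal) (use card B l noise_normal D_pos in auto)
  then have "distributed P lborel (batch_noise M \<eta> l i) (normal_density 0 (sqrt (real M * D)))"
    unfolding variance by (simp add: batch_noise_def[abs_def])
  from normal_density_affine[OF this, of "1 / sqrt (real M * D * real K)" 0]
  show ?thesis
    using M_pos D_pos K_pos
    by (simp add: scaled_noise_def[abs_def] real_sqrt_mult real_sqrt_divide)
qed

lemma measurable_unit_data:
  assumes "p \<in> unit_coordinates J K"
  shows "(\<lambda>\<omega>. unit_data \<omega> p) \<in> borel_measurable P"
  using indep_unit_data assms by (auto simp: indep_vars_def2)

lemma measurable_restrict_unit_data:
  "(\<lambda>\<omega>. restrict (unit_data \<omega>) (unit_coordinates J K))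
     \<in> P \<rightarrow>\<^sub>M PiM (unit_coordinates J K) (\<lambda>_. borel)"
  by (intro measurable_restrict measurable_unit_data)

lemma distr_unit_data:
  "distr P (PiM (unit_coordinates J K) (\<lambda>_. borel)) (\<lambda>\<omega>. restrict (unit_data \<omega>) (unit_coordinates J K))
     = unit_law J K"
proof -
  have "(1, 1) \<in> {1..J} \<times> {1..K}" using J_ge_2 J_le_K by auto
  then have ne: "unit_coordinates J K \<noteq> {}" unfolding unit_coordinates_def by blast
  have "distr P borel (\<lambda>\<omega>. unit_data \<omega> p) =
     (case p of Inl _ \<Rightarrow> density lborel (normal_density 0 (sqrt (1 / real K)))
      | Inr _ \<Rightarrow> density lborel (exponential_density 1))"
    if p: "p \<in> unit_coordinates J K" for p
  proof -
    have eq: "distr P borel X = density lborel f"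
      if D: "distributed P lborel X f" for X :: "'w \<Rightarrow> real" and f
    proof -
      have "distr P borel X = distr P lborel X" by (rule distr_cong) auto
      also have "\<dots> = density lborel f" by (rule distributed_distr_eq_density[OF D])
      finally show ?thesis .
    qed
    show ?thesis using p eq[OF scaled_noise_normal] eq[OF zeta_exponential]
      by (auto simp: unit_coordinates_def)
  qed
  then show ?thesis
    using indep_vars_iff_distr_eq_PiM'[where M' = "\<lambda>_. borel" and X = "\<lambda>p \<omega>. unit_data \<omega> p", OF ne]
      measurable_unit_data indep_unit_data
    unfolding unit_law_def by (simp cong: PiM_cong)
qed

section \<open>Invariant description\<close>

lemma share_eq: "share K (\<lambda>i. y i \<omega>) l k = batch_count y l k \<omega> / real K"
  by (simp add: share_def batch_count_def used_def)

text \<open>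
  The initial round uses every arm once, so no bound is computed with a vanishing count.
\<close>

lemma share_choices_pos:
  assumes "\<omega> \<in> space P" "k \<in> {J..K}" "l \<in> {1..J}"
  shows "0 < share K (\<lambda>i. y i \<omega>) l k"
  by (rule share_pos[of J]) (use assms K_pos initial_choices in auto)

lemma scaled_bound_formula:
  assumes "\<omega> \<in> space P" "k \<in> {J..K}" "l \<in> {1..J}"
  shows "u l k \<omega> = d l + (\<Sum>i=1..k. used y l i \<omega> * scaled_noise M D K \<eta> l i \<omega>)
      / (batch_count y l k \<omega> / real K)
    + a / sqrt (batch_count y l k \<omega> / real K) * (2 + \<zeta> l k \<omega>)"
proof -
  define b where "b = batch_count y l k \<omega>"
  define s where "s = (\<Sum>i=1..k. used y l i \<omega> * batch_noise M \<eta> l i \<omega>)"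
  have b: "0 < b" using share_choices_pos[OF assms] K_pos by (simp add: share_eq b_def zero_less_divide_iff)
  have noise: "(\<Sum>i=1..k. used y l i \<omega> * scaled_noise M D K \<eta> l i \<omega>) = s / sqrt (real M * D * real K)"
    by (simp add: s_def scaled_noise_def sum_divide_distrib)
  have arm: "real M * (d l * sqrt (D / real N)) = d l * (sqrt (real M * D) / sqrt (real K))"
  proof -
    have "real M = sqrt (real M) * sqrt (real M)" by simp
    then show ?thesis using M_pos K_pos D_pos by (simp add: N_eq real_sqrt_mult real_sqrt_divide field_simps)
  qed
  have "upper_bound (arm_mean m d D N) M D a \<eta> \<zeta> y l k \<omega> - real M * m
      = d l * (sqrt (real M * D) / sqrt (real K)) + s / b + a * sqrt (real M * D) / sqrt b * (2 + \<zeta> l k \<omega>)"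
    unfolding upper_bound_def cum_income_eq[OF M_pos] b_def[symmetric] s_def[symmetric] arm[symmetric]
    using b by (simp add: arm_mean_def field_simps)
  then have "u l k \<omega> = (d l * (sqrt (real M * D) / sqrt (real K)) + s / b
      + a * sqrt (real M * D) / sqrt b * (2 + \<zeta> l k \<omega>)) / sqrt (real M * D) * sqrt (real K)"
    by (simp add: scaled_bound_def)
  also have "\<dots> = d l + s / sqrt (real M * D * real K) / (b / real K) + a / sqrt (b / real K) * (2 + \<zeta> l k \<omega>)"
  proof -
    define r q where "r = sqrt (real M * D)" and "q = sqrt (real K)"
    \<comment> \<open>Naming the roots turns the claim into a rational identity.\<close>
    have pos: "0 < r" "0 < q" "0 < sqrt b"
      using M_pos D_pos K_pos b by (simp_all add: r_def q_def)
    have K: "real K = q * q" by (simp add: q_def)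
    have roots: "sqrt (real M * D * real K) = r * q" "sqrt (b / real K) = sqrt b / q"
      by (simp_all add: r_def q_def real_sqrt_mult real_sqrt_divide)
    show ?thesis unfolding roots r_def[symmetric] q_def[symmetric] unfolding K using b pos
      by (simp add: field_simps)
  qed
  finally show ?thesis unfolding noise b_def .
qed

lemma scaled_bound_eq_unit_index:
  assumes "\<omega> \<in> space P" "k \<in> {J..K}" "l \<in> {1..J}"
  shows "u l k \<omega> = unit_index K a d (\<lambda>i. y i \<omega>) (unit_data \<omega>) l k"
  using scaled_bound_formula[OF assms] by (simp add: unit_index_def share_eq used_def)

lemma scaled_bound_le_iff:
  "u j k \<omega> \<le> u l k \<omega> \<longleftrightarrow>
    upper_bound (arm_mean m d D N) M D a \<eta> \<zeta> y j k \<omega> \<le> upper_bound (arm_mean m d D N) M D a \<eta> \<zeta> y l k \<omega>"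
proof -
  have "0 < real M * D" using M_pos D_pos by simp
  then show ?thesis using K_pos by (simp add: scaled_bound_def divide_le_cancel)
qed

section \<open>The choices are a function of the data\<close>

text \<open>
  Solving the equality of two indices for the coordinate \<open>p = \<zeta> l k\<close> expresses it through \<open>f\<close>, a
  function of the remaining coordinates: the choices up to \<open>k\<close> use the randomization of earlier steps only, and
  the index of arm \<open>j \<noteq> l\<close> uses \<open>\<zeta> j k\<close> instead. This is an equality between a variable with a
  density and one independent of it.
\<close>

lemma no_ties:
  assumes k: "k \<in> {J..K}" and l: "l \<in> {1..J}" and j: "j \<in> {1..J}" and "j \<noteq> l"
  shows "AE \<omega> in P. unit_index K a d (choice \<omega>) (unit_data \<omega>) j k
    \<noteq> unit_index K a d (choice \<omega>) (unit_data \<omega>) l k"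
proof -
  define p :: "nat \<times> nat + nat \<times> nat" where "p = Inr (l, k)"
  define I where "I = unit_coordinates J K - {p}"
  define c where "c = ucb_choice J K a d"
  define t where "t z = share K (c z) l k" for z
  define f where "f z = (unit_index K a d (c z) z j k - d l
      - (\<Sum>i=1..k. (if c z i = l then 1 else 0) * z (Inl (l, i))) / t z) * sqrt (t z) / a - 2" for z
  have p: "p \<in> unit_coordinates J K" using k l by (auto simp: p_def unit_coordinates_def)
  have choice_eq: "c (restrict z I) i = c z i" if "i \<le> k" for z i
    unfolding c_def by (rule ucb_choice_past)
      (use that k in \<open>auto simp: past_def I_def unit_coordinates_def p_def\<close>)
  have noise_eq: "restrict z I (Inl (r, i)) = z (Inl (r, i))" if "i \<in> {1..k}" "r \<in> {1..J}" for z r i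
    using that k by (auto simp: I_def unit_coordinates_def p_def)
  have "f (restrict z I) = f z" for z
  proof -
    have "unit_index K a d (c (restrict z I)) (restrict z I) j k = unit_index K a d (c z) z j k"
      by (rule unit_index_cong) (use choice_eq noise_eq k j \<open>j \<noteq> l\<close> in
          \<open>auto simp: I_def unit_coordinates_def p_def\<close>)
    moreover have "t (restrict z I) = t z"
      unfolding t_def by (rule share_cong) (simp add: choice_eq)
    moreover have "(\<Sum>i=1..k. (if c (restrict z I) i = l then 1 else 0) * restrict z I (Inl (l, i)))
        = (\<Sum>i=1..k. (if c z i = l then 1 else 0) * z (Inl (l, i)))"
      by (intro sum.cong refl arg_cong2[where f = "(*)"] noise_eq)
         (use choice_eq l in \<open>simp_all del: restrict_apply\<close>)
    ultimately show ?thesis by (simp add: f_def)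
  qed
  moreover have "f \<in> PiM I (\<lambda>_. borel) \<rightarrow>\<^sub>M borel"
  proof -
    have [measurable]: "t \<in> borel_measurable (PiM I (\<lambda>_. borel))"
      unfolding t_def c_def by (rule measurable_share) measurable
    show ?thesis unfolding f_def[abs_def] c_def by measurable
  qed
  ultimately have "indep_var borel (\<lambda>\<omega>. f (unit_data \<omega>)) borel (\<lambda>\<omega>. unit_data \<omega> p)"
    using indep_var_function_of_other_coordinates[OF indep_unit_data p] unfolding I_def by blast
  then have "AE \<omega> in P. f (unit_data \<omega>) \<noteq> unit_data \<omega> p"
    by (rule AE_indep_absolutely_continuous_neq[where f = "exponential_density 1"])
       (use zeta_exponential[OF l k] in \<open>simp add: p_def\<close>)
  moreover have "unit_index K a d (choice \<omega>) (unit_data \<omega>) j k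
    = unit_index K a d (choice \<omega>) (unit_data \<omega>) l k \<Longrightarrow> f (unit_data \<omega>) = unit_data \<omega> p" for \<omega>
  proof -
    assume eq: "unit_index K a d (choice \<omega>) (unit_data \<omega>) j k
      = unit_index K a d (choice \<omega>) (unit_data \<omega>) l k"
    have "0 < t (unit_data \<omega>)"
      unfolding t_def c_def by (rule share_pos[of J]) (use k l K_pos in \<open>auto simp: ucb_choice_initial\<close>)
    then show ?thesis
      unfolding f_def c_def eq unfolding unit_index_def t_def c_def p_def using a_pos by (simp add: field_simps)
  qed
  ultimately show ?thesis by (auto elim!: eventually_mono)
qed

text \<open>
  Both claims are derived on one event of probability one, because they support each other: absence of ties
  is known for the recursive choices, so it yields a strict maximum of the actual bounds only once the
  actual choices are known to coincide with the recursive ones up to \<open>k\<close>; and the strict maximum then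
  settles choice \<open>k + 1\<close>.
\<close>

lemma choices_strict_and_eq:
  "AE \<omega> in P. (\<forall>k\<in>{J..<K}. \<forall>l\<in>{1..J}. l \<noteq> y (k + 1) \<omega> \<longrightarrow> u l k \<omega> < u (y (k + 1) \<omega>) k \<omega>)
    \<and> (\<forall>i\<in>{1..K}. y i \<omega> = choice \<omega> i)"
proof -
  have "AE \<omega> in P. \<forall>k\<in>{J..K}. \<forall>l\<in>{1..J}. \<forall>j\<in>{1..J} - {l}.
      unit_index K a d (choice \<omega>) (unit_data \<omega>) j k \<noteq> unit_index K a d (choice \<omega>) (unit_data \<omega>) l k"
    by (intro AE_finite_allI no_ties) auto
  then show ?thesis using greedy_choices AE_space
  proof eventually_elim
    case (elim \<omega>)
    note unique = elim(1) and greedy = elim(2) and space = elim(3)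
    have strict: "u l k \<omega> < u (y (k + 1) \<omega>) k \<omega>"
      if eq: "\<And>i. i \<in> {1..k} \<Longrightarrow> y i \<omega> = choice \<omega> i"
        and k: "k \<in> {J..<K}" and l: "l \<in> {1..J}" "l \<noteq> y (k + 1) \<omega>" for k l
    proof -
      have y: "y (k + 1) \<omega> \<in> {1..J}"
        using measurable_space[OF choice_measurable space, of "k + 1"] k by simp
      have index: "u r k \<omega> = unit_index K a d (choice \<omega>) (unit_data \<omega>) r k" if "r \<in> {1..J}" for r
      proof -
        have "u r k \<omega> = unit_index K a d (\<lambda>i. y i \<omega>) (unit_data \<omega>) r k"
          using k that by (intro scaled_bound_eq_unit_index space) auto
        also have "\<dots> = unit_index K a d (choice \<omega>) (unit_data \<omega>) r k"
          by (rule unit_index_cong) (simp_all add: eq)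
        finally show ?thesis .
      qed
      have "u l k \<omega> \<le> u (y (k + 1) \<omega>) k \<omega>"
        using greedy k l by (simp add: scaled_bound_le_iff)
      moreover have "u l k \<omega> \<noteq> u (y (k + 1) \<omega>) k \<omega>"
        using unique k l y index by (metis Diff_iff atLeastAtMost_iff atLeastLessThan_iff less_imp_le_nat singletonD)
      ultimately show ?thesis by simp
    qed
    have eq: "i \<in> {1..K} \<Longrightarrow> y i \<omega> = choice \<omega> i" for i
    proof (induction i rule: less_induct)
      case (less i)
      show ?case
      proof (cases "i \<le> J")
        case True
        then show ?thesis using less.prems initial_choices space by (simp add: ucb_choice_initial)
      next
        case False
        then obtain k where k: "i = Suc k" "J \<le> k" by (cases i) auto
        have past: "y r \<omega> = choice \<omega> r" if "r \<in> {1..k}" for r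
          using that k less by simp
        have kK: "k \<in> {J..<K}" using k less.prems by simp
        have "unit_index K a d (choice \<omega>) (unit_data \<omega>) r k = u r k \<omega>" if "r \<in> {1..J}" for r
        proof -
          have "unit_index K a d (choice \<omega>) (unit_data \<omega>) r k
              = unit_index K a d (\<lambda>i. y i \<omega>) (unit_data \<omega>) r k"
            by (rule unit_index_cong) (simp_all add: past)
          then show ?thesis using kK that by (simp add: scaled_bound_eq_unit_index[OF space])
        qed
        then have "choice \<omega> i = first_maximizer J (\<lambda>r. u r k \<omega>)"
          unfolding k(1) ucb_choice_greedy[OF k(2)] by (rule first_maximizer_cong)
        also have "\<dots> = y i \<omega>"
          using strict[OF past kK] measurable_space[OF choice_measurable[OF less.prems] space] k
          by (intro first_maximizer_strict) simp_all
        finally show ?thesis by simp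
      qed
    qed
    then show ?case using strict by simp
  qed
qed

lemma choices_strict:
  "AE \<omega> in P. \<forall>k\<in>{J..<K}. \<forall>l\<in>{1..J}. l \<noteq> y (k + 1) \<omega> \<longrightarrow> u l k \<omega> < u (y (k + 1) \<omega>) k \<omega>"
  using choices_strict_and_eq by eventually_elim blast

lemma choices_eq: "AE \<omega> in P. \<forall>i\<in>{1..K}. y i \<omega> = choice \<omega> i"
  using choices_strict_and_eq by eventually_elim blast

lemma measurable_choice:
  assumes "i \<in> {1..K}"
  shows "y i \<in> P \<rightarrow>\<^sub>M count_space UNIV"
  using measurable_compose[OF choice_measurable[OF assms], of id] by (simp add: comp_def)

lemma measurable_used:
  assumes "i \<in> {1..K}"
  shows "used y l i \<in> borel_measurable P"
proof -
  note measurable_choice[OF assms, measurable]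
  show ?thesis unfolding used_def[abs_def] by measurable
qed

lemma measurable_scaled_bound:
  assumes k: "k \<in> {J..K}" and l: "l \<in> {1..J}"
  shows "u l k \<in> borel_measurable P"
proof -
  have "(\<lambda>\<omega>. unit_index K a d (\<lambda>i. y i \<omega>) (unit_data \<omega>) l k) \<in> borel_measurable P"
    using k l by (intro measurable_unit_index measurable_choice measurable_unit_data)
      (auto simp: unit_coordinates_def)
  then show ?thesis
    using scaled_bound_eq_unit_index[OF _ k l] by (subst measurable_cong) auto
qed

end

section \<open>Dependence on the number of batches only\<close>

text \<open>
  The canonical version of the random element whose law is \<open>joint_law\<close>, free of \<open>M\<close>, \<open>N\<close>, \<open>D\<close> and \<open>m\<close>.
\<close>

definition unit_outcome ::
  "nat \<Rightarrow> nat \<Rightarrow> real \<Rightarrow> (nat \<Rightarrow> real) \<Rightarrow> unit_data \<Rightarrow> (nat \<times> nat \<Rightarrow> real) \<times> (nat \<times> nat \<Rightarrow> real)" where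
  "unit_outcome J K a d z =
     (\<lambda>(l, k)\<in>{1..J} \<times> {J..K}. unit_index K a d (ucb_choice J K a d z) z l k,
      \<lambda>(l, k)\<in>{1..J} \<times> {1..K}. if ucb_choice J K a d z k = l then 1 else 0)"

lemma ucb_choice_restrict:
  "i \<le> K \<Longrightarrow> ucb_choice J K a d (restrict z (unit_coordinates J K)) i = ucb_choice J K a d z i"
  by (rule ucb_choice_past) (auto simp: past_def unit_coordinates_def)

lemma unit_outcome_restrict:
  "unit_outcome J K a d (restrict z (unit_coordinates J K)) = unit_outcome J K a d z"
proof -
  have "unit_index K a d (ucb_choice J K a d (restrict z (unit_coordinates J K)))
      (restrict z (unit_coordinates J K)) l k = unit_index K a d (ucb_choice J K a d z) z l k"
    if "l \<in> {1..J}" "k \<in> {J..K}" for l k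
    using that by (intro unit_index_cong ucb_choice_restrict) (auto simp: unit_coordinates_def)
  then show ?thesis
    unfolding unit_outcome_def by (auto simp: ucb_choice_restrict intro!: restrict_ext)
qed

lemma measurable_unit_outcome:
  "unit_outcome J K a d \<in> PiM I (\<lambda>_. borel) \<rightarrow>\<^sub>M
     (\<Pi>\<^sub>M p\<in>{1..J} \<times> {J..K}. borel) \<Otimes>\<^sub>M (\<Pi>\<^sub>M p\<in>{1..J} \<times> {1..K}. borel)"
  unfolding unit_outcome_def[abs_def]
  by (intro measurable_Pair measurable_restrict) (auto split: prod.split)

context batch_ucb_bandit
begin

lemma joint_law_eq:
  "joint_law P J K u y = distr (unit_law J K)
     ((\<Pi>\<^sub>M p\<in>{1..J} \<times> {J..K}. borel) \<Otimes>\<^sub>M (\<Pi>\<^sub>M p\<in>{1..J} \<times> {1..K}. borel)) (unit_outcome J K a d)"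
proof -
  let ?T = "(\<Pi>\<^sub>M p\<in>{1..J} \<times> {J..K}. borel) \<Otimes>\<^sub>M (\<Pi>\<^sub>M p\<in>{1..J} \<times> {1..K}. borel)
    :: ((nat \<times> nat \<Rightarrow> real) \<times> (nat \<times> nat \<Rightarrow> real)) measure"
  note restrict = measurable_restrict_unit_data
  have "distr (unit_law J K) ?T (unit_outcome J K a d)
      = distr P ?T (\<lambda>\<omega>. unit_outcome J K a d (unit_data \<omega>))"
    unfolding distr_unit_data[symmetric]
    by (subst distr_distr[OF measurable_unit_outcome restrict])
       (simp add: comp_def unit_outcome_restrict)
  also have "\<dots> = joint_law P J K u y"
    unfolding joint_law_def
  proof (rule distr_cong_AE[OF refl refl])
    show "AE \<omega> in P. unit_outcome J K a d (unit_data \<omega>)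
      = (\<lambda>(l, k)\<in>{1..J} \<times> {J..K}. u l k \<omega>, \<lambda>(l, k)\<in>{1..J} \<times> {1..K}. used y l k \<omega>)"
      using choices_eq AE_space
    proof eventually_elim
      case (elim \<omega>)
      have "unit_index K a d (choice \<omega>) (unit_data \<omega>) l k = u l k \<omega>"
        if "l \<in> {1..J}" "k \<in> {J..K}" for l k
        unfolding scaled_bound_eq_unit_index[OF elim(2) that(2,1)]
        by (rule unit_index_cong) (use elim(1) that in auto)
      then show ?case
        using elim(1) unfolding unit_outcome_def by (auto simp: used_def intro!: restrict_ext)
    qed
    show "(\<lambda>\<omega>. unit_outcome J K a d (unit_data \<omega>)) \<in> P \<rightarrow>\<^sub>M ?T"
      using measurable_compose[OF restrict measurable_unit_outcome[of J K a d]]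
      by (simp only: unit_outcome_restrict)
    show "(\<lambda>\<omega>. (\<lambda>(l, k)\<in>{1..J} \<times> {J..K}. u l k \<omega>, \<lambda>(l, k)\<in>{1..J} \<times> {1..K}. used y l k \<omega>)) \<in> P \<rightarrow>\<^sub>M ?T"
      by (intro measurable_Pair measurable_restrict)
         (auto intro: measurable_scaled_bound measurable_used)
  qed
  finally show ?thesis by simp
qed

lemma expectation_used:
  assumes i: "i \<in> {1..K}"
  shows "(LINT \<omega>|P. used y l i \<omega>) = (LINT z|unit_law J K. (if ucb_choice J K a d z i = l then 1 else 0))"
proof -
  note restrict = measurable_restrict_unit_data
  have [measurable]: "(\<lambda>z. if ucb_choice J K a d z i = l then 1 else 0 :: real)
      \<in> borel_measurable (PiM (unit_coordinates J K) (\<lambda>_. borel))"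
    by measurable
  have "(LINT z|unit_law J K. (if ucb_choice J K a d z i = l then 1 else 0 :: real))
      = (LINT \<omega>|P. (if choice \<omega> i = l then 1 else 0))"
    unfolding distr_unit_data[symmetric]
    using i by (subst integral_distr[OF restrict]) (auto simp: ucb_choice_restrict)
  also have "\<dots> = (LINT \<omega>|P. used y l i \<omega>)"
  proof (rule integral_cong_AE)
    show "(\<lambda>\<omega>. if choice \<omega> i = l then 1 else 0 :: real) \<in> borel_measurable P"
      using measurable_compose[OF restrict, of "\<lambda>z. if ucb_choice J K a d z i = l then 1 else 0 :: real" borel] i
      by (simp add: ucb_choice_restrict)
    show "used y l i \<in> borel_measurable P" by (rule measurable_used[OF i])
    show "AE \<omega> in P. (if choice \<omega> i = l then 1 else 0) = used y l i \<omega>"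
      using choices_eq by eventually_elim (use i in \<open>auto simp: used_def\<close>)
  qed
  finally show ?thesis by simp
qed

section \<open>Scaled loss\<close>

lemma integrable_used:
  assumes "i \<in> {1..K}"
  shows "integrable P (used y l i)"
  by (rule integrable_const_bound[of _ 1]) (use measurable_used[OF assms] in \<open>auto simp: used_def\<close>)

text \<open>
  The choice for batch \<open>i\<close> depends on earlier batches, hence is independent of the noise \<open>Y l i\<close> of batch
  \<open>i\<close> itself, and the expectation of the product factorizes.
\<close>

lemma used_noise_mean_zero:
  assumes l: "l \<in> {1..J}" and i: "i \<in> {1..K}"
  shows "integrable P (\<lambda>\<omega>. used y l i \<omega> * scaled_noise M D K \<eta> l i \<omega>)" (is ?integrable)
    and "(LINT \<omega>|P. used y l i \<omega> * scaled_noise M D K \<eta> l i \<omega>) = 0" (is ?mean)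
proof -
  define p :: "nat \<times> nat + nat \<times> nat" where "p = Inl (l, i)"
  define f :: "unit_data \<Rightarrow> real" where "f z = (if ucb_choice J K a d z i = l then 1 else 0)" for z
  let ?Y = "scaled_noise M D K \<eta> l i"
  have p: "p \<in> unit_coordinates J K" using i l by (auto simp: p_def unit_coordinates_def)
  have "f (restrict z (unit_coordinates J K - {p})) = f z" for z
  proof -
    have "ucb_choice J K a d (restrict z (unit_coordinates J K - {p})) i = ucb_choice J K a d z i"
      by (rule ucb_choice_past) (use i in \<open>auto simp: past_def unit_coordinates_def p_def\<close>)
    then show ?thesis by (simp add: f_def)
  qed
  moreover have "f \<in> PiM (unit_coordinates J K - {p}) (\<lambda>_. borel) \<rightarrow>\<^sub>M borel"
    unfolding f_def[abs_def] by measurable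
  ultimately have "indep_var borel (\<lambda>\<omega>. f (unit_data \<omega>)) borel (\<lambda>\<omega>. unit_data \<omega> p)"
    using indep_var_function_of_other_coordinates[OF indep_unit_data p] by blast
  then have indep: "indep_var borel (\<lambda>\<omega>. f (unit_data \<omega>)) borel ?Y"
    by (simp add: p_def)
  have Y: "integrable P ?Y" "(LINT \<omega>|P. ?Y \<omega>) = 0"
  proof -
    note normal = scaled_noise_normal[OF l i]
    show "integrable P ?Y"
      by (rule distributed_integrable_var[OF normal]) (use K_pos integrable_normal_moment_nz_1 in auto)
    show "(LINT \<omega>|P. ?Y \<omega>) = 0"
      by (rule normal_distributed_expectation[OF _ normal]) (use K_pos in simp)
  qed
  have f: "integrable P (\<lambda>\<omega>. f (unit_data \<omega>))"
    using indep_var_rv1[OF indep] by (intro integrable_const_bound[of _ 1]) (auto simp: f_def)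
  have AE: "AE \<omega> in P. f (unit_data \<omega>) * ?Y \<omega> = used y l i \<omega> * ?Y \<omega>"
    using choices_eq by eventually_elim (use i in \<open>auto simp: used_def f_def\<close>)
  have meas: "(\<lambda>\<omega>. f (unit_data \<omega>) * ?Y \<omega>) \<in> borel_measurable P"
    "(\<lambda>\<omega>. used y l i \<omega> * ?Y \<omega>) \<in> borel_measurable P"
    using f Y(1) measurable_used[OF i] by (auto intro: borel_measurable_times)
  show ?integrable
    using indep_var_integrable[OF indep f Y(1)] integrable_cong_AE[OF meas AE] by simp
  show ?mean
    using indep_var_lebesgue_integral[OF indep f Y(1)] integral_cong_AE[OF meas AE] Y(2) by simp
qed

text \<open>
  In a batch with arm \<open>l\<close> the regret is \<open>M\<close> times the gap minus the batch noise; dividing by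
  \<open>sqrt (D N)\<close> turns these into \<open>(max d - d l) / K\<close> and \<open>Y l i\<close>. Exactly one arm is used in each batch,
  so the sum over \<open>l\<close> weighted by the indicators selects its term.
\<close>

lemma regret_pathwise:
  assumes \<omega>: "\<omega> \<in> space P"
  shows "(\<Sum>n=1..N. Max (arm_mean m d D N ` {1..J}) - income (arm_mean m d D N) M \<eta> y n \<omega>) / sqrt (D * real N)
    = (\<Sum>l=1..J. \<Sum>i=1..K. (Max (d ` {1..J}) - d l) / real K * used y l i \<omega>
        - used y l i \<omega> * scaled_noise M D K \<eta> l i \<omega>)"
proof -
  define \<theta> where "\<theta> = arm_mean m d D N"
  define best where "best = Max (\<theta> ` {1..J})"
  have J: "d ` {1..J} \<noteq> {}" using J_ge_2 by auto
  have best: "best = m + Max (d ` {1..J}) * sqrt (D / real N)"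
  proof -
    have "mono (\<lambda>x. m + x * sqrt (D / real N))"
      using D_pos by (intro monoI add_left_mono mult_right_mono) auto
    from mono_Max_commute[OF this _ J] show ?thesis
      by (simp add: best_def \<theta>_def image_image arm_mean_def[abs_def])
  qed
  have scale: "(real M * (best - \<theta> l) - batch_noise M \<eta> l i \<omega>) / sqrt (D * real N)
      = (Max (d ` {1..J}) - d l) / real K - scaled_noise M D K \<eta> l i \<omega>" for l i
  proof -
    define g where "g = Max (d ` {1..J}) - d l"
    have N: "D * real N = real M * D * real K" by (simp add: N_eq)
    have "real M * (best - \<theta> l) = g * (real M * sqrt (D / real N))"
      by (simp add: best \<theta>_def arm_mean_def g_def algebra_simps)
    also have "real M * sqrt (D / real N) = sqrt (D * real N) / real K"
      using M_pos K_pos D_pos by (simp add: N_eq real_sqrt_mult real_sqrt_divide field_simps)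
    finally show ?thesis
      using D_pos M_pos K_pos
      unfolding g_def[symmetric] scaled_noise_def N[symmetric]
      by (simp add: diff_divide_distrib N_eq)
  qed
  have "(\<Sum>n=1..N. best - income \<theta> M \<eta> y n \<omega>)
      = (\<Sum>i=1..K. \<Sum>n=(i - 1) * M + 1..i * M. best - (\<theta> (y i \<omega>) + \<eta> (y i \<omega>) n \<omega>))"
    unfolding income_def Let_def N_eq mult.commute[of M K] by (rule sum_batch_of[OF M_pos])
  also have "\<dots> = (\<Sum>i=1..K. \<Sum>l=1..J. used y l i \<omega> * (real M * (best - \<theta> l) - batch_noise M \<eta> l i \<omega>))"
  proof (rule sum.cong[OF refl])
    fix i assume i: "i \<in> {1..K}"
    then obtain j where j: "i = Suc j" by (cases i) auto
    have y: "y i \<omega> \<in> {1..J}" using measurable_space[OF choice_measurable[OF i] \<omega>] by simp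
    have "(\<Sum>n=(i - 1) * M + 1..i * M. best - (\<theta> (y i \<omega>) + \<eta> (y i \<omega>) n \<omega>))
        = real M * best - (real M * \<theta> (y i \<omega>) + batch_noise M \<eta> (y i \<omega>) i \<omega>)"
      using i sum_income_over_batch[of i \<theta> "y i \<omega>" \<eta> \<omega> M] by (simp add: sum_subtractf j)
    also have "\<dots> = (\<Sum>l=1..J. used y l i \<omega> * (real M * (best - \<theta> l) - batch_noise M \<eta> l i \<omega>))"
    proof -
      have "(\<Sum>l=1..J. used y l i \<omega> * (real M * (best - \<theta> l) - batch_noise M \<eta> l i \<omega>))
          = (\<Sum>l=1..J. if y i \<omega> = l then real M * (best - \<theta> l) - batch_noise M \<eta> l i \<omega> else 0)"
        by (rule sum.cong) (auto simp: used_def)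
      then show ?thesis using y by (simp add: algebra_simps)
    qed
    finally show "(\<Sum>n=(i - 1) * M + 1..i * M. best - (\<theta> (y i \<omega>) + \<eta> (y i \<omega>) n \<omega>))
        = (\<Sum>l=1..J. used y l i \<omega> * (real M * (best - \<theta> l) - batch_noise M \<eta> l i \<omega>))" .
  qed
  finally have "(\<Sum>n=1..N. best - income \<theta> M \<eta> y n \<omega>) / sqrt (D * real N)
      = (\<Sum>i=1..K. \<Sum>l=1..J. used y l i \<omega> *
          ((real M * (best - \<theta> l) - batch_noise M \<eta> l i \<omega>) / sqrt (D * real N)))"
    by (simp add: sum_divide_distrib)
  also have "\<dots> = (\<Sum>l=1..J. \<Sum>i=1..K. (Max (d ` {1..J}) - d l) / real K * used y l i \<omega>
        - used y l i \<omega> * scaled_noise M D K \<eta> l i \<omega>)"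
    unfolding scale by (subst sum.swap) (simp add: algebra_simps)
  finally show ?thesis by (simp add: \<theta>_def best_def)
qed

lemma scaled_loss_eq:
  "scaled_loss P J M N D m d \<eta> y = (\<Sum>l=1..J. (Max (d ` {1..J}) - d l) *
     (\<Sum>i=1..K. 1 / real K * (LINT \<omega>|P. used y l i \<omega>)))"
proof -
  have "scaled_loss P J M N D m d \<eta> y = (LINT \<omega>|P.
      (\<Sum>n=1..N. Max (arm_mean m d D N ` {1..J}) - income (arm_mean m d D N) M \<eta> y n \<omega>) / sqrt (D * real N))"
    by (simp add: scaled_loss_def loss_def)
  also have "\<dots> = (LINT \<omega>|P. (\<Sum>l=1..J. \<Sum>i=1..K. (Max (d ` {1..J}) - d l) / real K * used y l i \<omega>
        - used y l i \<omega> * scaled_noise M D K \<eta> l i \<omega>))"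
    by (rule Bochner_Integration.integral_cong[OF refl]) (rule regret_pathwise)
  also have "\<dots> = (\<Sum>l=1..J. \<Sum>i=1..K. (Max (d ` {1..J}) - d l) / real K * (LINT \<omega>|P. used y l i \<omega>))"
  proof -
    define g where "g l = (Max (d ` {1..J}) - d l) / real K" for l
    define F where "F l i \<omega> = g l * used y l i \<omega> - used y l i \<omega> * scaled_noise M D K \<eta> l i \<omega>" for l i \<omega>
    have F: "integrable P (F l i)" "(LINT \<omega>|P. F l i \<omega>) = g l * (LINT \<omega>|P. used y l i \<omega>)"
      if "l \<in> {1..J}" "i \<in> {1..K}" for l i
      using integrable_used[OF that(2), of l] used_noise_mean_zero[OF that]
      unfolding F_def[abs_def] by simp_all
    have "(LINT \<omega>|P. (\<Sum>l=1..J. \<Sum>i=1..K. F l i \<omega>)) = (\<Sum>l=1..J. \<Sum>i=1..K. (LINT \<omega>|P. F l i \<omega>))"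
      by (subst Bochner_Integration.integral_sum)
         (intro Bochner_Integration.integrable_sum Bochner_Integration.integral_sum F sum.cong refl; assumption)+
    also have "\<dots> = (\<Sum>l=1..J. \<Sum>i=1..K. g l * (LINT \<omega>|P. used y l i \<omega>))"
      by (intro sum.cong refl F)
    finally show ?thesis by (simp only: F_def g_def)
  qed
  finally show ?thesis by (simp add: sum_distrib_left)
qed

lemma integral_sum_used:
  "(LINT \<omega>|P. (\<Sum>i=1..K. c * used y l i \<omega>)) = (\<Sum>i=1..K. c * (LINT \<omega>|P. used y l i \<omega>))"
  by (simp add: integrable_used del: One_nat_def)

text \<open>
  Arm \<open>1\<close> has gap zero, which leaves the arms \<open>2, \<dots>, J\<close>.
\<close>

lemma scaled_loss_best_first:
  assumes "d 1 = Max (d ` {1..J})"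
  shows "scaled_loss P J M N D m d \<eta> y
    = (\<Sum>l=2..J. (d 1 - d l) * (LINT \<omega>|P. (\<Sum>i=1..K. 1 / real K * used y l i \<omega>)))"
  using J_ge_2 unfolding scaled_loss_eq integral_sum_used assms[symmetric]
  by (subst sum.atLeast_Suc_atMost) (simp_all add: numeral_2_eq_2)

end

theorem theorem2p1:
  fixes P :: "'w measure" and J K M N :: nat and C D a m :: real and d :: "nat \<Rightarrow> real"
    and \<eta> \<zeta> :: "nat \<Rightarrow> nat \<Rightarrow> 'w \<Rightarrow> real" and y :: "nat \<Rightarrow> 'w \<Rightarrow> nat"
  assumes "batch_ucb_bandit P J K M N C D a m d \<eta> \<zeta> y"
  shows
    "(let \<epsilon> = 1 / real K;
          U = upper_bound (arm_mean m d D N) M D a \<eta> \<zeta> y;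
          u = scaled_bound K M N D a m d \<eta> \<zeta> y;
          Y = scaled_noise M D K \<eta>
      in
        prob_space.indep_vars P (\<lambda>_. borel) (\<lambda>(l, i). Y l i) ({1..J} \<times> {1..K})
        \<and> (\<forall>l\<in>{1..J}. \<forall>i\<in>{1..K}. distributed P lborel (Y l i) (normal_density 0 (sqrt \<epsilon>)))
        \<and> (\<forall>\<omega>\<in>space P. \<forall>k\<in>{J..K}. \<forall>j\<in>{1..J}. \<forall>l\<in>{1..J}. U j k \<omega> \<le> U l k \<omega> \<longleftrightarrow> u j k \<omega> \<le> u l k \<omega>)
        \<and> (AE \<omega> in P. \<forall>k\<in>{J..<K}. \<forall>l\<in>{1..J}. l \<noteq> y (k + 1) \<omega> \<longrightarrow> u l k \<omega> < u (y (k + 1) \<omega>) k \<omega>)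
        \<and> (\<forall>\<omega>\<in>space P. \<forall>k\<in>{J..K}. \<forall>l\<in>{1..J}.
             let t_l = batch_count y l k \<omega> / real K in
               u l k \<omega> = d l + (\<Sum>i=1..k. used y l i \<omega> * Y l i \<omega>) / t_l
                         + a / sqrt t_l * (2 + \<zeta> l k \<omega>))
        \<and> (d 1 = Max (d ` {1..J}) \<longrightarrow>
             scaled_loss P J M N D m d \<eta> y
             = (\<Sum>l=2..J. (d 1 - d l) * (LINT \<omega>|P. (\<Sum>k=1..K. \<epsilon> * used y l k \<omega>))))
        \<and> (\<forall>(P' :: 'v measure) M' N' C' D' m' \<eta>' \<zeta>' y'.
             batch_ucb_bandit P' J K M' N' C' D' a m' d \<eta>' \<zeta>' y' \<longrightarrow>
               joint_law P' J K (scaled_bound K M' N' D' a m' d \<eta>' \<zeta>' y') y' = joint_law P J K u y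
               \<and> scaled_loss P' J M' N' D' m' d \<eta>' y' = scaled_loss P J M N D m d \<eta> y))"
proof -
  interpret batch_ucb_bandit P J K M N C D a m d \<eta> \<zeta> y by fact
  have indep: "indep_vars (\<lambda>_. borel) (\<lambda>(l, i). scaled_noise M D K \<eta> l i) ({1..J} \<times> {1..K})"
  proof -
    have "indep_vars (\<lambda>_. borel) (\<lambda>q \<omega>. unit_data \<omega> (Inl q)) ({1..J} \<times> {1..K})"
      by (rule indep_vars_reindex_inj[OF indep_unit_data])
         (auto simp: inj_on_def unit_coordinates_def)
    moreover have "(\<lambda>q \<omega>. unit_data \<omega> (Inl q)) = (\<lambda>(l, i). scaled_noise M D K \<eta> l i)"
      by (auto simp: fun_eq_iff)
    ultimately show ?thesis by simp
  qed
  have other_bandit: "joint_law P' J K (scaled_bound K M' N' D' a m' d \<eta>' \<zeta>' y') y' = joint_law P J K u y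
      \<and> scaled_loss P' J M' N' D' m' d \<eta>' y' = scaled_loss P J M N D m d \<eta> y"
    if "batch_ucb_bandit P' J K M' N' C' D' a m' d \<eta>' \<zeta>' y'"
    for P' :: "'v measure" and M' N' C' D' m' \<eta>' \<zeta>' y'
  proof -
    interpret other: batch_ucb_bandit P' J K M' N' C' D' a m' d \<eta>' \<zeta>' y' by fact
    show ?thesis
      by (simp add: joint_law_eq other.joint_law_eq scaled_loss_eq other.scaled_loss_eq
          expectation_used other.expectation_used)
  qed
  show ?thesis
    unfolding Let_def
    by (intro conjI ballI impI allI;
        rule indep scaled_noise_normal scaled_bound_le_iff[symmetric] choices_strict
          scaled_bound_formula scaled_loss_best_first
          other_bandit[THEN conjunct1] other_bandit[THEN conjunct2]; assumption)
qed

end
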